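(* Let $a\in(0,1)$ be fixed. Then, as $n\to\infty$ through even integers, $$P_n^D\bigl(2;2\lfloor an/2\rfloor\bigr)=\log\left(1-\frac{2}{\sqrt{2\pi na(1-a)}}+O\bigl(n^{-3/2}\bigr)\right).$$
   Context: For even $n$, a Dyck path of length $n$ is a lattice path in $\mathbb{Z}^2$ from $(0,0)$ to $(n,0)$ with steps $(1,1)$ and $(1,-1)$ that never goes below the line $Y=0$. A visit is a vertex of the path on $Y=0$ other than the origin. For $z>0$ and even $n$, $D_n(z)=\sum z^{\#\text{visits}}$ over all Dyck paths of length $n$ (with $D_0(z)=1$). For even $q$ with $0<q<n$, the pressure of adsorbing Dyck paths at the vertex $(q,0)$ is $P_n^D(z;q)=\log D_n(z;q)-\log D_n(z)$, where $D_n(z;q)$ is the same sum as $D_n(z)$ restricted to paths not passing through $(q,0)$; equivalently $$P_n^D(z;q)=\log\left(1-\frac{D_q(z)\,D_{n-q}(z)}{D_n(z)}\right).$$ *)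

theory Defs
  imports "HOL-Analysis.Analysis" "HOL-Library.Landau_Symbols"
begin

(* A lattice path starting at the origin is encoded by its list of steps. *)

definition path_vertices :: "(int \<times> int) list \<Rightarrow> (int \<times> int) set" where
  "path_vertices p = {sum_list (take i p) | i. i \<le> length p}"

definition dyck_paths :: "nat \<Rightarrow> (int \<times> int) list set" where
  "dyck_paths n = {p. length p = n \<and> set p \<subseteq> {(1, 1), (1, -1)} \<and>
     sum_list p = (int n, 0) \<and> (\<forall>v\<in>path_vertices p. snd v \<ge> 0)}"

definition visits :: "(int \<times> int) list \<Rightarrow> (int \<times> int) set" where
  "visits p = {v \<in> path_vertices p. snd v = 0 \<and> v \<noteq> (0, 0)}"

definition dyck_partition :: "nat \<Rightarrow> real \<Rightarrow> real" where
  "dyck_partition n z = (\<Sum>p\<in>dyck_paths n. z ^ card (visits p))"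

definition dyck_partition_avoiding :: "nat \<Rightarrow> real \<Rightarrow> nat \<Rightarrow> real" where
  "dyck_partition_avoiding n z q =
     (\<Sum>p\<in>{p \<in> dyck_paths n. (int q, 0) \<notin> path_vertices p}. z ^ card (visits p))"

definition dyck_pressure :: "nat \<Rightarrow> real \<Rightarrow> nat \<Rightarrow> real" where
  "dyck_pressure n z q = ln (dyck_partition_avoiding n z q) - ln (dyck_partition n z)"

definition even_at_top :: "nat filter" where
  "even_at_top = inf at_top (principal {n. even n})"

(* The sums above are genuine: a sum over an infinite set would be 0 by convention. *)
lemma finite_dyck_paths: "finite (dyck_paths n)"
proof (rule finite_subset)
  show "dyck_paths n \<subseteq> {p. set p \<subseteq> {(1, 1), (1, -1)} \<and> length p = n}"
    by (auto simp: dyck_paths_def)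
  show "finite {p. set p \<subseteq> {(1 :: int, 1 :: int), (1, -1)} \<and> length p = n}"
    by (rule finite_lists_length_eq) simp
qed

lemma dyck_partition_0: "dyck_partition 0 z = 1"
proof -
  have "dyck_paths 0 = {[]}"
    by (auto simp: dyck_paths_def path_vertices_def zero_prod_def)
  moreover have "visits [] = {}"
    by (auto simp: visits_def path_vertices_def zero_prod_def)
  ultimately show ?thesis
    by (simp add: dyck_partition_def)
qed

end

(* Weight 2 per return to the axis turns Dyck paths into signed walks, so the partition function of
   length 2m is the central binomial coefficient C(2m, m). By the renewal property, the pressure is
   the logarithm of 1 - R, where R = C(2k, k) C(2(m-k), m-k) / C(2m, m) and k = floor (a m).
   Monotonicity together with Wallis' product gives
   2 / (pi (2m+1)) <= (C(2m, m) / 4^m)^2 <= 1 / (pi m), hence the square of R up to O(1/m^2).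
   Dividing the difference of squares by the leading term, of order m^(-1/2), gives O(m^(-3/2)). *)

theory Submission
  imports Defs
begin

section \<open>Walks as step lists\<close>

abbreviation lattice_steps :: "(int \<times> int) set" where
  "lattice_steps \<equiv> {(1, 1), (1, -1)}"

text \<open>Only the height is tracked, since every step advances the abscissa by 1. A variable
  starting height makes induction on the first step possible; nonnegativity is tested after each
  step, not at the start.\<close>

primrec walk :: "int \<Rightarrow> (int \<times> int) list \<Rightarrow> int \<Rightarrow> bool" where
  "walk h [] e \<longleftrightarrow> h = e"
| "walk h (s # p) e \<longleftrightarrow> s \<in> lattice_steps \<and> 0 \<le> h + snd s \<and> walk (h + snd s) p e"

text \<open>The starting point is never counted, just as the origin is no visit; this makes the
  count additive under concatenation.\<close>

primrec zeros :: "int \<Rightarrow> (int \<times> int) list \<Rightarrow> nat" where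
  "zeros h [] = 0"
| "zeros h (s # p) = of_bool (h + snd s = 0) + zeros (h + snd s) p"

definition walks :: "nat \<Rightarrow> int \<Rightarrow> (int \<times> int) list set" where
  "walks n h = {p. length p = n \<and> walk h p 0}"

lemma fst_sum_list_steps:
  "set p \<subseteq> lattice_steps \<Longrightarrow> fst (sum_list p) = int (length p)"
  by (induction p) auto

lemma sum_list_take_steps:
  assumes "set p \<subseteq> lattice_steps" "i \<le> length p"
  shows "sum_list (take i p) = (int i, snd (sum_list (take i p)))"
proof -
  have "set (take i p) \<subseteq> lattice_steps"
    using assms(1) set_take_subset[of i p] by blast
  from fst_sum_list_steps[OF this] assms(2) show ?thesis
    by (simp add: prod_eq_iff)
qed

text \<open>Links the recursion to the prefix sums that define Dyck paths. The hypothesis on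
  \<open>h\<close> supplies the empty prefix, which \<open>walk\<close> does not test.\<close>

lemma walk_iff:
  "0 \<le> h \<Longrightarrow> walk h p e \<longleftrightarrow> set p \<subseteq> lattice_steps \<and> h + snd (sum_list p) = e \<and>
     (\<forall>i \<le> length p. 0 \<le> h + snd (sum_list (take i p)))"
proof (induction p arbitrary: h)
  case (Cons s p)
  have "(\<forall>i \<le> length (s # p). 0 \<le> h + snd (sum_list (take i (s # p)))) \<longleftrightarrow>
      (\<forall>i \<le> length p. 0 \<le> h + snd s + snd (sum_list (take i p)))" (is "?L \<longleftrightarrow> ?R")
  proof
    assume ?L
    show ?R
    proof (intro allI impI)
      fix i assume "i \<le> length p"
      with \<open>?L\<close>[rule_format, of "Suc i"] show "0 \<le> h + snd s + snd (sum_list (take i p))"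
        by (simp add: add.assoc)
    qed
  next
    assume ?R
    show ?L
    proof (intro allI impI)
      fix i assume "i \<le> length (s # p)"
      with \<open>?R\<close>[rule_format, of "i - 1"] Cons.prems
      show "0 \<le> h + snd (sum_list (take i (s # p)))"
        by (cases i) (auto simp: add.assoc)
    qed
  qed
  moreover have "walk h (s # p) e \<longleftrightarrow> s \<in> lattice_steps \<and> 0 \<le> h + snd s \<and>
      set p \<subseteq> lattice_steps \<and> h + snd s + snd (sum_list p) = e \<and>
      (\<forall>i \<le> length p. 0 \<le> h + snd s + snd (sum_list (take i p)))"
    using Cons.IH[of "h + snd s"] by auto
  moreover have "0 \<le> h + snd s" if ?R
    using that[rule_format, of 0] by simp
  ultimately show ?case
    by (auto simp: add.assoc)
qed auto

lemma zeros_eq_card: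
  "zeros h p = card {i \<in> {1..length p}. h + snd (sum_list (take i p)) = 0}"
proof (induction p arbitrary: h)
  case (Cons s p)
  let ?A = "{i \<in> {1..length p}. h + snd s + snd (sum_list (take i p)) = 0}"
  have "{i \<in> {1..length (s # p)}. h + snd (sum_list (take i (s # p))) = 0} =
      (if h + snd s = 0 then {1} else {}) \<union> Suc ` ?A" (is "?L = ?R")
  proof (rule set_eqI)
    fix i
    show "i \<in> ?L \<longleftrightarrow> i \<in> ?R"
    proof (cases i)
      case (Suc j)
      \<comment> \<open>Index 1 is the vertex after the first step \<open>s\<close>; larger indices
        are shifted indices of the tail.\<close>
      then show ?thesis by (cases j) (auto simp: add.assoc)
    qed auto
  qed
  moreover have "card ((if h + snd s = 0 then {1} else {}) \<union> Suc ` ?A) =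
      card (if h + snd s = 0 then {1 :: nat} else {}) + card (Suc ` ?A)"
    by (rule card_Un_disjoint) auto
  moreover have "card (Suc ` ?A) = card ?A"
    by (rule card_image) simp
  ultimately show ?case
    using Cons.IH[of "h + snd s"] by simp
qed simp

lemma walk_append:
  "walk h (p @ r) e \<longleftrightarrow> walk h p (h + snd (sum_list p)) \<and> walk (h + snd (sum_list p)) r e"
  by (induction p arbitrary: h) (auto simp: add.assoc)

lemma zeros_append: "zeros h (p @ r) = zeros h p + zeros (h + snd (sum_list p)) r"
  by (induction p arbitrary: h) (auto simp: add.assoc)

lemma walk_end: "walk h p e \<Longrightarrow> h + snd (sum_list p) = e"
proof (induction p arbitrary: h)
  case (Cons s p)
  then have "h + snd s + snd (sum_list p) = e" by simp
  then show ?case by (simp add: add.assoc)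
qed simp

lemma walk_steps: "walk h p e \<Longrightarrow> set p \<subseteq> lattice_steps"
  by (induction p arbitrary: h) auto

lemma dyck_paths_eq_walks: "dyck_paths n = walks n 0"
proof -
  have "p \<in> dyck_paths n \<longleftrightarrow> p \<in> walks n 0" for p
  proof -
    have "sum_list p = (int (length p), 0) \<longleftrightarrow> snd (sum_list p) = 0"
      if "set p \<subseteq> lattice_steps"
      using fst_sum_list_steps[OF that] by (auto simp: prod_eq_iff)
    moreover have "(\<forall>v\<in>path_vertices p. snd v \<ge> 0) \<longleftrightarrow>
        (\<forall>i \<le> length p. 0 \<le> snd (sum_list (take i p)))"
      unfolding path_vertices_def by blast
    moreover have "walk 0 p 0 \<longleftrightarrow> set p \<subseteq> lattice_steps \<and> snd (sum_list p) = 0 \<and>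
        (\<forall>i \<le> length p. 0 \<le> snd (sum_list (take i p)))"
      using walk_iff[of 0 p 0] by simp
    ultimately show ?thesis
      unfolding dyck_paths_def walks_def by blast
  qed
  then show ?thesis by blast
qed

lemma finite_walks: "finite (walks n h)"
proof (rule finite_subset)
  show "walks n h \<subseteq> {p. set p \<subseteq> lattice_steps \<and> length p = n}"
    using walk_steps by (auto simp: walks_def)
  show "finite {p. set p \<subseteq> lattice_steps \<and> length p = n}"
    by (rule finite_lists_length_eq) simp
qed

text \<open>The vertex with index \<open>i\<close> has abscissa \<open>i\<close>, so distinct
  indices give distinct vertices and the set of visits can be counted by indices. Dropping the
  origin amounts to dropping index 0.\<close>

lemma visits_card:
  assumes "p \<in> walks n 0"
  shows "card (visits p) = zeros 0 p"
proof -
  let ?A = "{i \<in> {1..length p}. 0 + snd (sum_list (take i p)) = 0}"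
  have steps: "set p \<subseteq> lattice_steps"
    using assms walk_steps by (auto simp: walks_def)
  have "visits p = (\<lambda>i. (int i, 0)) ` ?A"
  proof (rule set_eqI)
    fix v
    have "v \<in> visits p \<longleftrightarrow> (\<exists>i \<le> length p. v = sum_list (take i p) \<and> snd v = 0 \<and> v \<noteq> (0, 0))"
      by (auto simp: visits_def path_vertices_def)
    also have "\<dots> \<longleftrightarrow> (\<exists>i \<in> ?A. v = (int i, 0))"
    proof -
      have "(v = sum_list (take i p) \<and> snd v = 0 \<and> v \<noteq> (0, 0)) \<longleftrightarrow> i \<in> ?A \<and> v = (int i, 0)"
        if "i \<le> length p" for i
      proof -
        have "v = sum_list (take i p) \<longleftrightarrow> v = (int i, snd (sum_list (take i p)))"
          using sum_list_take_steps[OF steps that] by simp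
        then show ?thesis using that by (cases v) auto
      qed
      then show ?thesis by auto
    qed
    finally show "v \<in> visits p \<longleftrightarrow> v \<in> (\<lambda>i. (int i, 0)) ` ?A" by blast
  qed
  moreover have "card ((\<lambda>i. (int i, 0 :: int)) ` ?A) = card ?A"
    by (rule card_image) (auto simp: inj_on_def)
  ultimately show ?thesis
    using zeros_eq_card[of 0 p] by simp
qed

lemma vertex_on_axis_iff:
  assumes "p \<in> walks n 0" "q \<le> n"
  shows "(int q, 0) \<in> path_vertices p \<longleftrightarrow> snd (sum_list (take q p)) = 0"
proof -
  have steps: "set p \<subseteq> lattice_steps" and len: "length p = n"
    using assms walk_steps by (auto simp: walks_def)
  show ?thesis
  proof
    assume "(int q, 0) \<in> path_vertices p"
    then obtain i where i: "i \<le> length p" "(int q, 0) = sum_list (take i p)"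
      by (auto simp: path_vertices_def)
    with sum_list_take_steps[OF steps i(1)] show "snd (sum_list (take q p)) = 0"
      by (metis fst_conv snd_conv of_nat_eq_iff)
  next
    assume "snd (sum_list (take q p)) = 0"
    with sum_list_take_steps[OF steps, of q] assms(2) len
    have "(int q, 0) = sum_list (take q p)" by simp
    then show "(int q, 0) \<in> path_vertices p"
      using assms(2) len by (auto simp: path_vertices_def)
  qed
qed

section \<open>Renewal at a vertex and the partition function at \<open>z = 2\<close>\<close>

lemma dyck_partition_eq: "dyck_partition n z = (\<Sum>p\<in>walks n 0. z ^ zeros 0 p)"
  unfolding dyck_partition_def dyck_paths_eq_walks
  by (rule sum.cong) (auto simp: visits_card)

text \<open>Cutting at \<open>q\<close> is a bijection from the paths through that vertex to pairs
  of Dyck paths. The weight factorises because the visit at \<open>q\<close> belongs to the first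
  piece only.\<close>

lemma dyck_partition_avoiding_eq:
  assumes "q \<le> n"
  shows "dyck_partition_avoiding n z q =
    dyck_partition n z - dyck_partition q z * dyck_partition (n - q) z"
proof -
  let ?T = "{p \<in> walks n 0. snd (sum_list (take q p)) = 0}"
  let ?f = "\<lambda>p. z ^ zeros 0 p"
  have avoid: "dyck_partition_avoiding n z q = sum ?f (walks n 0 - ?T)"
    unfolding dyck_partition_avoiding_def dyck_paths_eq_walks
    by (rule sum.cong) (auto simp: visits_card vertex_on_axis_iff[OF _ assms])
  have "sum ?f ?T = (\<Sum>(p, r)\<in>walks q 0 \<times> walks (n - q) 0. ?f p * ?f r)"
  proof (rule sym, rule sum.reindex_bij_witness[where i = "\<lambda>p. (take q p, drop q p)"
        and j = "\<lambda>(p, r). p @ r"])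
    fix x assume x: "x \<in> walks q 0 \<times> walks (n - q) 0"
    obtain p r where pr: "x = (p, r)" by (cases x)
    have len: "length p = q" "length r = n - q" and wk: "walk 0 p 0" "walk 0 r 0"
      using x pr by (auto simp: walks_def)
    have height: "snd (sum_list p) = 0"
      using walk_end[OF wk(1)] by simp
    show "(take q (case x of (p, r) \<Rightarrow> p @ r), drop q (case x of (p, r) \<Rightarrow> p @ r)) = x"
      using pr len by simp
    show "(case x of (p, r) \<Rightarrow> p @ r) \<in> ?T"
      using pr len wk height assms by (auto simp: walks_def walk_append)
    show "?f (case x of (p, r) \<Rightarrow> p @ r) = (case x of (p, r) \<Rightarrow> ?f p * ?f r)"
      using pr height by (simp add: zeros_append power_add)
  next
    fix p assume p: "p \<in> ?T"
    show "(case (take q p, drop q p) of (p, r) \<Rightarrow> p @ r) = p" by simp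
    show "(take q p, drop q p) \<in> walks q 0 \<times> walks (n - q) 0"
      using p assms walk_append[of 0 "take q p" "drop q p" 0] by (auto simp: walks_def)
  qed
  also have "\<dots> = dyck_partition q z * dyck_partition (n - q) z"
    unfolding dyck_partition_eq sum_product sum.cartesian_product by simp
  finally show ?thesis
    unfolding avoid using sum_diff[OF finite_walks, of ?T n 0 ?f]
    by (auto simp: dyck_partition_eq)
qed

section \<open>First-step recursion and comparison with unconstrained walks\<close>

lemma walks_Suc:
  assumes "0 \<le> h"
  shows "walks (Suc n) h =
    (#) (1, 1) ` walks n (h + 1) \<union> (if h = 0 then {} else (#) (1, -1) ` walks n (h - 1))"
proof (rule set_eqI)
  fix p
  show "p \<in> walks (Suc n) h \<longleftrightarrow> p \<in> (#) (1, 1) ` walks n (h + 1) \<union>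
      (if h = 0 then {} else (#) (1, -1) ` walks n (h - 1))"
    using assms by (cases p) (auto simp: walks_def image_iff)
qed

text \<open>A first step up never lands on the axis; a first step down lands there exactly from
  height 1, which costs a factor \<open>z\<close>, and is forbidden from height 0.\<close>

lemma sum_walks_Suc:
  fixes z :: real
  assumes "0 \<le> h"
  shows "(\<Sum>p\<in>walks (Suc n) h. z ^ zeros h p) = (\<Sum>p\<in>walks n (h + 1). z ^ zeros (h + 1) p) +
    (if h = 0 then 0 else z ^ of_bool (h = 1) * (\<Sum>p\<in>walks n (h - 1). z ^ zeros (h - 1) p))"
proof -
  have up: "(\<Sum>p\<in>(#) (1, 1) ` walks n (h + 1). z ^ zeros h p) =
      (\<Sum>p\<in>walks n (h + 1). z ^ zeros (h + 1) p)"
    using assms by (subst sum.reindex) auto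
  have down: "(\<Sum>p\<in>(#) (1, -1) ` walks n (h - 1). z ^ zeros h p) =
      z ^ of_bool (h = 1) * (\<Sum>p\<in>walks n (h - 1). z ^ zeros (h - 1) p)"
    by (subst sum.reindex) (auto simp: power_add sum_distrib_left)
  show ?thesis
  proof (cases "h = 0")
    case True
    then show ?thesis using walks_Suc[OF assms, of n] up by simp
  next
    case False
    have "(\<Sum>p\<in>walks (Suc n) h. z ^ zeros h p) =
        (\<Sum>p\<in>(#) (1, 1) ` walks n (h + 1). z ^ zeros h p) +
        (\<Sum>p\<in>(#) (1, -1) ` walks n (h - 1). z ^ zeros h p)"
      unfolding walks_Suc[OF assms] using False
      by (simp, subst sum.union_disjoint) (auto simp: finite_walks)
    then show ?thesis using False up down by simp
  qed
qed

text \<open>The number of unconstrained walks with \<open>n\<close> steps of size 1 from height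
  \<open>h\<close> to 0: the binomial coefficient chooses the \<open>(n + h) div 2\<close>
  down-steps, and the wrong parity gives none.\<close>

definition free_walk_count :: "nat \<Rightarrow> nat \<Rightarrow> nat" where
  "free_walk_count n h = (if even (n + h) then n choose ((n + h) div 2) else 0)"

text \<open>Pascal's rule, that is, conditioning on the first step.\<close>

lemma free_walk_count_Suc_Suc:
  "free_walk_count (Suc n) (Suc h) = free_walk_count n (Suc (Suc h)) + free_walk_count n h"
proof (cases "even (n + h)")
  case True
  then obtain j where "n + h = 2 * j" by (rule evenE)
  then have "Suc n + Suc h = 2 * Suc j" "n + Suc (Suc h) = 2 * Suc j" by auto
  with \<open>n + h = 2 * j\<close> show ?thesis
    unfolding free_walk_count_def by (simp only: nonzero_mult_div_cancel_left) simp
qed (simp add: free_walk_count_def)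

text \<open>From the axis the first step leads to height 1 or -1, and by symmetry both give the same
  count.\<close>

lemma free_walk_count_Suc_0: "free_walk_count (Suc n) 0 = 2 * free_walk_count n 1"
proof (cases "odd n")
  case True
  then obtain j where n: "n = 2 * j + 1" by (rule oddE)
  then have "Suc n + 0 = 2 * Suc j" "n + 1 = 2 * Suc j" by auto
  moreover have "n choose Suc j = n choose j"
    using n binomial_symmetric[of j n] by simp
  ultimately show ?thesis
    unfolding free_walk_count_def by (simp only: nonzero_mult_div_cancel_left) simp
qed (simp add: free_walk_count_def)

text \<open>Reflecting excursions in the axis: weight 2 per return to the axis counts free walks, with an
  extra factor 2 for the sign of the initial segment when it starts off the axis.\<close>

lemma sum_walks_closed_form:
  "(\<Sum>p\<in>walks n (int h). (2 :: real) ^ zeros (int h) p) =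
     (if h = 0 then 1 else 2) * real (free_walk_count n h)"
proof (induction n arbitrary: h)
  case 0
  have "walks 0 (int h) = (if h = 0 then {[]} else {})"
    by (auto simp: walks_def)
  then show ?case
    by (auto simp: free_walk_count_def)
next
  case (Suc n)
  show ?case
  proof (cases h)
    case 0
    then show ?thesis
      using Suc[of 1] sum_walks_Suc[of 0 2 n] by (simp add: free_walk_count_Suc_0)
  next
    case (Suc k)
    \<comment> \<open>The coefficient of \<open>free_walk_count n k\<close> is 2 in either case: for
      \<open>k = 0\<close> the return weight replaces the sign factor, which is 1 on the
      axis.\<close>
    have "(\<Sum>p\<in>walks (n + 1) (int h). (2 :: real) ^ zeros (int h) p) =
        2 * real (free_walk_count n (Suc h)) +
        2 ^ of_bool (k = 0) * ((if k = 0 then 1 else 2) * real (free_walk_count n k))"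
      using Suc.IH[of "Suc h"] Suc.IH[of k] sum_walks_Suc[of "int h" 2 n] Suc
      by (simp add: algebra_simps)
    then show ?thesis
      using Suc free_walk_count_Suc_Suc[of n k] by (cases "k = 0") auto
  qed
qed

lemma dyck_partition_2: "dyck_partition (2 * m) 2 = real ((2 * m) choose m)"
  using sum_walks_closed_form[where n = "2 * m" and h = 0]
  by (simp add: dyck_partition_eq free_walk_count_def)

section \<open>Central binomial coefficients\<close>

text \<open>The probability that a simple symmetric walk is back at its start at time
  \<open>2 * m\<close>.\<close>

definition return_prob :: "nat \<Rightarrow> real" where
  "return_prob m = real ((2 * m) choose m) / 4 ^ m"

lemma return_prob_pos: "0 < return_prob m"
  by (simp add: return_prob_def)

lemma return_prob_Suc: "return_prob (Suc m) = return_prob m * ((2 * real m + 1) / (2 * real m + 2))"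
proof -
  have "Suc m * (Suc (Suc (2 * m)) choose Suc m) = Suc (Suc (2 * m)) * (Suc (2 * m) choose m)"
    by (rule Suc_times_binomial)
  moreover have "Suc m * (Suc (2 * m) choose Suc m) = Suc (2 * m) * (2 * m choose m)"
    by (rule Suc_times_binomial)
  moreover have "Suc (2 * m) choose Suc m = Suc (2 * m) choose m"
    using binomial_symmetric[of m "Suc (2 * m)"] by simp
  ultimately have "Suc m * (2 * Suc m choose Suc m) = 2 * (Suc (2 * m) * (2 * m choose m))"
    by (metis mult_2 add_Suc_right add_Suc mult.assoc)
  then have "real (Suc m) * real (2 * Suc m choose Suc m) = 2 * (real (Suc (2 * m)) * real (2 * m choose m))"
    by (metis of_nat_mult of_nat_numeral)
  then have "real (2 * Suc m choose Suc m) =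
      2 * ((2 * real m + 1) * real (2 * m choose m)) / (real m + 1)"
    by (simp only: eq_divide_eq) (simp add: mult.commute add.commute)
  then have "return_prob (Suc m) =
      2 * ((2 * real m + 1) * real (2 * m choose m)) / (real m + 1) / (4 * 4 ^ m)"
    unfolding return_prob_def by (simp only: power_Suc)
  then show ?thesis
    by (simp add: return_prob_def divide_simps)
qed

text \<open>Both sides start at 1 and gain the factor
  \<open>(2 * n + 1) * (2 * n + 3) / (2 * n + 2) ^ 2\<close> in passing from \<open>n\<close> to
  \<open>n + 1\<close>.\<close>

lemma wallis_return_prob:
  "(2 * real n + 1) * return_prob n ^ 2 =
     inverse (\<Prod>k=1..n. (4 * real k ^ 2) / (4 * real k ^ 2 - 1))"
proof (induction n)
  case 0
  show ?case by (simp add: return_prob_def)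
next
  case (Suc n)
  have factor: "4 * real (Suc n) ^ 2 - 1 = (2 * real n + 1) * (2 * real n + 3)"
    by (simp add: power2_eq_square algebra_simps)
  have "(2 * real (Suc n) + 1) * return_prob (Suc n) ^ 2 =
      ((2 * real n + 1) * return_prob n ^ 2) *
      (((2 * real n + 1) * (2 * real n + 3)) / (4 * real (Suc n) ^ 2))"
    unfolding return_prob_Suc by (simp add: divide_simps power2_eq_square) (simp add: algebra_simps)
  then show ?case
    unfolding Suc.IH factor[symmetric] by (simp add: prod.nat_ivl_Suc' field_simps)
qed

lemma wallis_limit: "(\<lambda>n. (2 * real n + 1) * return_prob n ^ 2) \<longlonglongrightarrow> 2 / pi"
  using tendsto_inverse[OF wallis] by (simp add: wallis_return_prob)

text \<open>The Wallis sequence decreases, as \<open>(2 * n + 1) * (2 * n + 3)\<close> is one less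
  than \<open>(2 * n + 2) ^ 2\<close>; hence each term is at least the limit.\<close>

lemma return_prob_lower: "2 / (pi * (2 * real n + 1)) \<le> return_prob n ^ 2"
proof -
  have "decseq (\<lambda>n. (2 * real n + 1) * return_prob n ^ 2)"
  proof (rule decseq_SucI)
    fix n
    have "(2 * real (Suc n) + 1) * return_prob (Suc n) ^ 2 =
        ((2 * real n + 1) * return_prob n ^ 2) *
        (((2 * real n + 1) * (2 * real n + 3)) / (2 * real n + 2) ^ 2)"
      unfolding return_prob_Suc by (simp add: divide_simps power2_eq_square)
    also have "\<dots> \<le> ((2 * real n + 1) * return_prob n ^ 2) * 1"
      by (intro mult_left_mono) (simp_all add: power2_eq_square divide_simps, simp add: algebra_simps)
    finally show "(2 * real (Suc n) + 1) * return_prob (Suc n) ^ 2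
        \<le> (2 * real n + 1) * return_prob n ^ 2" by simp
  qed
  from decseq_ge[OF this wallis_limit, of n] show ?thesis
    by (subst pos_divide_le_eq) (auto simp: divide_simps algebra_simps add_pos_nonneg)
qed

text \<open>Normalised by \<open>n\<close> instead of \<open>2 * n + 1\<close>, the sequence
  increases to its limit \<open>1 / pi\<close>.\<close>

lemma return_prob_upper: "0 < n \<Longrightarrow> return_prob n ^ 2 \<le> 1 / (pi * real n)"
proof -
  assume n: "0 < n"
  have "incseq (\<lambda>n. real n * return_prob n ^ 2)"
  proof (rule incseq_SucI)
    fix n
    \<comment> \<open>The right side exceeds the left by exactly \<open>n + 1\<close>.\<close>
    have "real n * (2 * real n + 2) ^ 2 \<le> (real n + 1) * (2 * real n + 1) ^ 2"
      by (simp add: power2_eq_square algebra_simps)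
    then have "real n \<le> (real n + 1) * ((2 * real n + 1) / (2 * real n + 2)) ^ 2"
      by (simp add: power_divide pos_le_divide_eq)
    then have "real n * return_prob n ^ 2 \<le>
        (real n + 1) * ((2 * real n + 1) / (2 * real n + 2)) ^ 2 * return_prob n ^ 2"
      by (rule mult_right_mono) simp
    also have "\<dots> = real (Suc n) * return_prob (Suc n) ^ 2"
      unfolding return_prob_Suc power_mult_distrib by simp
    finally show "real n * return_prob n ^ 2 \<le> real (Suc n) * return_prob (Suc n) ^ 2" .
  qed
  moreover have "(\<lambda>n. real n * return_prob n ^ 2) \<longlonglongrightarrow> 1 / pi"
  proof -
    have "(\<lambda>n. real n / (2 * real n + 1)) \<longlonglongrightarrow> 1 / 2"
    proof -
      have "(\<lambda>n. inverse (real (Suc (2 * n)))) \<longlonglongrightarrow> 0"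
        using LIMSEQ_subseq_LIMSEQ[OF LIMSEQ_inverse_real_of_nat, of "\<lambda>n. 2 * n"]
        by (simp add: strict_mono_def o_def)
      from tendsto_mult[OF tendsto_const[of "1 / 2"] tendsto_diff[OF tendsto_const[of 1] this]]
      have "(\<lambda>n. 1 / 2 * (1 - inverse (real (Suc (2 * n))))) \<longlonglongrightarrow> 1 / 2"
        by simp
      moreover have "1 / 2 * (1 - inverse (real (Suc (2 * n)))) = real n / (2 * real n + 1)" for n
        by (simp add: field_simps)
      ultimately show ?thesis by (simp only:)
    qed
    from tendsto_mult[OF this wallis_limit] 
    have "(\<lambda>n. real n / (2 * real n + 1) * ((2 * real n + 1) * return_prob n ^ 2)) \<longlonglongrightarrow> 1 / pi"
      by simp
    moreover have "real n / (2 * real n + 1) * ((2 * real n + 1) * return_prob n ^ 2) =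
        real n * return_prob n ^ 2" for n
      by (simp add: field_simps add_pos_pos)
    ultimately show ?thesis by simp
  qed
  ultimately have "real n * return_prob n ^ 2 \<le> 1 / pi"
    by (rule incseq_le)
  with n show ?thesis
    by (simp add: field_simps)
qed

section \<open>Two-sided bounds for the bridge probability\<close>

text \<open>The probability that a walk bridge of length \<open>2 m\<close> is at the origin at time \<open>2 k\<close>.\<close>

definition bridge_prob :: "nat \<Rightarrow> nat \<Rightarrow> real" where
  "bridge_prob m k = return_prob k * return_prob (m - k) / return_prob m"

lemma bridge_prob_pos: "0 < bridge_prob m k"
  by (simp add: bridge_prob_def return_prob_pos)

text \<open>The powers of 4 cancel, so this is the ratio produced by the renewal identity.\<close>

lemma bridge_prob_eq:
  assumes "k \<le> m"
  shows "bridge_prob m k =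
    dyck_partition (2 * k) 2 * dyck_partition (2 * m - 2 * k) 2 / dyck_partition (2 * m) 2"
proof -
  have "dyck_partition (2 * j) 2 = 4 ^ j * return_prob j" for j
    by (simp add: dyck_partition_2 return_prob_def)
  moreover have "(4 :: real) ^ m = 4 ^ k * 4 ^ (m - k)"
    using assms by (simp flip: power_add)
  ultimately show ?thesis
    unfolding bridge_prob_def diff_mult_distrib2[symmetric] by simp
qed

text \<open>Upper bounds for both factors of the numerator are combined with the lower bound for the
  denominator, whose \<open>2 * m + 1\<close> yields the summand \<open>1 / 2\<close>.\<close>

lemma bridge_prob_upper:
  assumes "0 < k" "k < m"
  shows "bridge_prob m k ^ 2 \<le> (real m + 1 / 2) / (pi * (real k * real (m - k)))"
proof -
  have "bridge_prob m k ^ 2 = return_prob k ^ 2 * return_prob (m - k) ^ 2 / return_prob m ^ 2"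
    by (simp add: bridge_prob_def power_divide power_mult_distrib)
  also have "\<dots> \<le> (1 / (pi * real k)) * (1 / (pi * real (m - k))) / (2 / (pi * (2 * real m + 1)))"
    using assms return_prob_upper[of k] return_prob_upper[of "m - k"] return_prob_lower[of m]
    by (intro frac_le mult_mono) (auto intro!: divide_pos_pos mult_pos_pos add_nonneg_pos)
  also have "\<dots> = (real m + 1 / 2) / (pi * (real k * real (m - k)))"
    using assms by (simp add: divide_simps)
  finally show ?thesis .
qed

lemma bridge_prob_lower:
  assumes "0 < m"
  shows "real m / (pi * ((real k + 1 / 2) * (real (m - k) + 1 / 2))) \<le> bridge_prob m k ^ 2"
proof -
  have "real m / (pi * ((real k + 1 / 2) * (real (m - k) + 1 / 2))) =
      (2 / (pi * (2 * real k + 1))) * (2 / (pi * (2 * real (m - k) + 1))) / (1 / (pi * real m))"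
  proof -
    have "real k + 1 / 2 = (2 * real k + 1) / 2" "real (m - k) + 1 / 2 = (2 * real (m - k) + 1) / 2"
      by simp_all
    then show ?thesis by (simp only:) (simp add: assms mult.commute mult.left_commute)
  qed
  also have "\<dots> \<le> return_prob k ^ 2 * return_prob (m - k) ^ 2 / return_prob m ^ 2"
    using assms return_prob_upper[of m] return_prob_lower[of k] return_prob_lower[of "m - k"]
    by (intro frac_le mult_mono) (auto simp: less_imp_neq[OF return_prob_pos, symmetric])
  also have "\<dots> = bridge_prob m k ^ 2"
    by (simp add: bridge_prob_def power_divide power_mult_distrib)
  finally show ?thesis .
qed

text \<open>Keeps the argument of the logarithm positive for every interior vertex, not only
  asymptotically.\<close>

lemma bridge_prob_less_1:
  assumes "0 < k" "k < m"
  shows "bridge_prob m k < 1"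
proof -
  define x y where "x = real k" and "y = real (m - k)"
  have xy: "1 \<le> x" "1 \<le> y" "real m = x + y"
    using assms by (auto simp: x_def y_def)
  \<comment> \<open>This gives \<open>x + y + 1 / 2 \<le> x * y + 3 / 2\<close>, which is below
    \<open>3 * (x * y)\<close> because \<open>x * y \<ge> 1\<close>.\<close>
  then have "0 \<le> (x - 1) * (y - 1)" by simp
  then have "x + y + 1 / 2 < 3 * (x * y)"
    using xy by (simp add: algebra_simps)
  also have "\<dots> < pi * (x * y)"
    using xy pi_gt3 by (intro mult_strict_right_mono mult_pos_pos) auto
  finally have "(real m + 1 / 2) / (pi * (x * y)) < 1"
    using xy by (simp add: divide_simps mult_pos_pos)
  with bridge_prob_upper[OF assms] have "bridge_prob m k ^ 2 < 1"
    by (simp add: x_def y_def)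
  then show ?thesis
    using power2_less_imp_less[of "bridge_prob m k" 1] by simp
qed

lemma dyck_pressure_eq:
  assumes "0 < k" "k < m"
  shows "dyck_pressure (2 * m) 2 (2 * k) = ln (1 - bridge_prob m k)"
proof -
  have pos: "0 < dyck_partition (2 * m) 2"
    by (simp add: dyck_partition_2)
  have "dyck_partition_avoiding (2 * m) 2 (2 * k) =
      dyck_partition (2 * m) 2 * (1 - bridge_prob m k)"
    using assms pos by (simp add: dyck_partition_avoiding_eq bridge_prob_eq right_diff_distrib)
  with pos bridge_prob_less_1[OF assms] show ?thesis
    by (simp add: dyck_pressure_def ln_mult)
qed

section \<open>The error term\<close>

text \<open>Rounding changes \<open>k * (m - k)\<close> from \<open>a * (1 - a) * m ^ 2\<close> by
  O(m) only, so the upper and lower bounds for the square share the same leading term up to O(1 / m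
  ^ 2).\<close>

lemma bridge_prob_sq_error:
  fixes a :: real
  assumes a: "0 < a" "a < 1" and m: "2 \<le> a * real m" and k: "k = nat \<lfloor>a * real m\<rfloor>"
  shows "\<bar>bridge_prob m k ^ 2 - 1 / (pi * (a * (1 - a) * real m))\<bar>
    \<le> 6 / (pi * (a * (1 - a)) ^ 2 * real m ^ 2)"
proof -
  define b where "b = a * (1 - a)"
  define M where "M = real m"
  \<comment> \<open>The rounding error, so that \<open>real k = a * M - \<theta>\<close> and
    \<open>l = (1 - a) * M + \<theta>\<close>.\<close>
  define \<theta> where "\<theta> = a * M - real k"
  define l where "l = M - real k"
  have b: "0 < b" "b \<le> 1"
    using a by (auto simp: b_def mult_le_one)
  have "real k = of_int \<lfloor>a * real m\<rfloor>"
    using k a by simp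
  then have \<theta>: "0 \<le> \<theta>" "\<theta> < 1"
    unfolding \<theta>_def M_def by linarith+
  have "a * M < 1 * M"
    using a m by (intro mult_strict_right_mono) (auto simp: M_def intro: gr0I)
  then have kM: "real k < M" using \<theta> by (simp add: \<theta>_def)
  then have km: "k < m" and l: "real (m - k) = l" by (auto simp: M_def l_def)
  have M: "2 \<le> a * M" "2 \<le> M"
    using m \<open>a * M < 1 * M\<close> by (auto simp: M_def)
  \<comment> \<open>Rounding loses less than 1, which is at most half of
    \<open>a * M\<close>.\<close>
  have klow: "a * M / 2 \<le> real k" "1 \<le> real k"
    using \<theta> M by (auto simp: \<theta>_def)
  have llow: "(1 - a) * M \<le> l" "0 < l"
    using \<theta> kM by (auto simp: \<theta>_def l_def algebra_simps)
  have k0: "0 < k" using klow(2) by linarith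
  have prod_kl: "real k * l = b * M ^ 2 + \<theta> * M * (2 * a - 1) - \<theta> ^ 2"
    by (simp add: l_def b_def \<theta>_def power2_eq_square algebra_simps)
  have "b * M ^ 2 / 2 = (a * M / 2) * ((1 - a) * M)"
    by (simp add: b_def power2_eq_square)
  also have "\<dots> \<le> real k * l"
    using klow llow a M by (intro mult_mono) auto
  finally have kl_low: "b * M ^ 2 / 2 \<le> real k * l" .
  have "\<bar>\<theta> * M * (2 * a - 1)\<bar> \<le> 1 * M * 1"
    unfolding abs_mult using \<theta> a M by (intro mult_mono) auto
  moreover have "\<theta> ^ 2 \<le> 1" "0 \<le> \<theta> ^ 2"
    using \<theta> by (auto simp: power_le_one)
  ultimately have kl: "\<bar>b * M ^ 2 - real k * l\<bar> \<le> M + 1"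
    unfolding prod_kl by linarith
  have b_M: "0 \<le> b * M" "b * M \<le> M" using b M by auto
  \<comment> \<open>One estimate serves both bounds: \<open>x = M + 1 / 2\<close> with
    \<open>y = k * l\<close> above, and \<open>x = M\<close> with
    \<open>y = (k + 1 / 2) * (l + 1 / 2)\<close> below. The 6 is the numerator bound
    \<open>3 * M\<close> divided by the half in the lower bound for \<open>y\<close>.\<close>
  have diff: "\<bar>x / (pi * y) - 1 / (pi * (b * M))\<bar> \<le> 6 / (pi * b ^ 2 * M ^ 2)"
    if y: "b * M ^ 2 / 2 \<le> y" and num: "\<bar>x * (b * M) - y\<bar> \<le> 3 * M" for x y
  proof -
    have den: "0 < b * M ^ 2 / 2" using b M by simp
    have "0 < y" using den y by linarith
    have "x / (pi * y) - 1 / (pi * (b * M)) = (x * (b * M) - y) / (pi * (y * (b * M)))"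
      using \<open>0 < y\<close> b M by (simp add: divide_simps)
    then have "\<bar>x / (pi * y) - 1 / (pi * (b * M))\<bar> = \<bar>x * (b * M) - y\<bar> / (pi * (y * (b * M)))"
      using \<open>0 < y\<close> b M by (simp add: abs_mult)
    also have "\<dots> \<le> 3 * M / (pi * (b * M ^ 2 / 2 * (b * M)))"
      using num y b M by (intro frac_le mult_left_mono mult_right_mono) auto
    also have "\<dots> = 6 / (pi * b ^ 2 * M ^ 2)"
      using b M by (simp add: divide_simps power2_eq_square)
    finally show ?thesis .
  qed
  have "\<bar>(M + 1 / 2) * (b * M) - real k * l\<bar> \<le> 3 * M"
  proof -
    have "(M + 1 / 2) * (b * M) = b * M ^ 2 + b * M / 2"
      by (simp add: power2_eq_square algebra_simps)
    with kl M b_M show ?thesis by linarith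
  qed
  from diff[OF kl_low this]
  have up: "(M + 1 / 2) / (pi * (real k * l)) \<le> 1 / (pi * (b * M)) + 6 / (pi * b ^ 2 * M ^ 2)"
    by linarith
  have half: "(real k + 1 / 2) * (l + 1 / 2) = real k * l + M / 2 + 1 / 4"
    by (simp add: l_def algebra_simps)
  have "b * M ^ 2 / 2 \<le> (real k + 1 / 2) * (l + 1 / 2)"
    using kl_low M unfolding half by linarith
  moreover have "\<bar>M * (b * M) - (real k + 1 / 2) * (l + 1 / 2)\<bar> \<le> 3 * M"
  proof -
    have "M * (b * M) = b * M ^ 2" by (simp add: power2_eq_square)
    \<comment> \<open>The total is at most \<open>M + 1 + M / 2 + 1 / 4\<close>, which
      \<open>M \<ge> 2\<close> keeps below \<open>3 * M\<close>.\<close>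
    with kl M show ?thesis unfolding half by linarith
  qed
  ultimately have low: "1 / (pi * (b * M)) - 6 / (pi * b ^ 2 * M ^ 2) \<le>
      M / (pi * ((real k + 1 / 2) * (l + 1 / 2)))"
    using diff[of "(real k + 1 / 2) * (l + 1 / 2)" M] by linarith
  have "bridge_prob m k ^ 2 \<le> (M + 1 / 2) / (pi * (real k * l))"
    using bridge_prob_upper[OF k0 km] by (simp add: M_def l)
  moreover have "M / (pi * ((real k + 1 / 2) * (l + 1 / 2))) \<le> bridge_prob m k ^ 2"
    using bridge_prob_lower[of m k] km by (simp add: M_def l)
  ultimately show ?thesis
    using up low unfolding abs_le_iff b_def[symmetric] M_def[symmetric] by linarith
qed

lemma bridge_prob_error:
  fixes a :: real
  assumes a: "0 < a" "a < 1" and m: "2 \<le> a * real m" and k: "k = nat \<lfloor>a * real m\<rfloor>"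
  shows "\<bar>bridge_prob m k - 1 / sqrt (pi * (a * (1 - a) * real m))\<bar>
    \<le> 6 * sqrt (pi * (a * (1 - a))) / (pi * (a * (1 - a)) ^ 2) * real m powr (- 3 / 2)"
proof -
  define b where "b = a * (1 - a)"
  define M where "M = real m"
  define T where "T = 1 / sqrt (pi * (b * M))"
  let ?R = "bridge_prob m k"
  have b: "0 < b" using a by (simp add: b_def)
  have M: "0 < M" using a m by (auto simp: M_def intro: gr0I)
  have T: "0 < T" "T ^ 2 = 1 / (pi * (b * M))"
    using b M by (simp_all add: T_def power_divide)
  have "?R ^ 2 - T ^ 2 = (?R - T) * (?R + T)"
    by (simp add: power2_eq_square algebra_simps)
  then have "\<bar>?R - T\<bar> * (?R + T) = \<bar>?R ^ 2 - T ^ 2\<bar>"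
    using T(1) bridge_prob_pos[of m k] by (simp add: abs_mult)
  \<comment> \<open>Positivity of \<open>?R\<close> allows dividing by \<open>T\<close> alone, which
    costs a factor of order \<open>sqrt M\<close>.\<close>
  moreover have "\<bar>?R - T\<bar> * T \<le> \<bar>?R - T\<bar> * (?R + T)"
    using bridge_prob_pos[of m k] by (intro mult_left_mono) auto
  moreover have "\<bar>?R ^ 2 - T ^ 2\<bar> \<le> 6 / (pi * b ^ 2 * M ^ 2)"
    using bridge_prob_sq_error[OF assms] unfolding T by (simp add: b_def M_def)
  ultimately have "\<bar>?R - T\<bar> * T \<le> 6 / (pi * b ^ 2 * M ^ 2)" by linarith
  then have "\<bar>?R - T\<bar> \<le> 6 / (pi * b ^ 2 * M ^ 2) / T"
    using T(1) by (subst pos_le_divide_eq) auto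
  also have "\<dots> = 6 * sqrt (pi * b) / (pi * b ^ 2) * (sqrt M / M ^ 2)"
    using b M by (simp add: T_def real_sqrt_mult)
  also have "sqrt M / M ^ 2 = M powr (- 3 / 2)"
  proof -
    have "sqrt M / M ^ 2 = M powr (1 / 2) / M powr 2"
      using M by (simp add: powr_half_sqrt)
    then show ?thesis by (simp flip: powr_diff)
  qed
  finally show ?thesis by (simp add: T_def b_def M_def)
qed

theorem mainTheorem5:
  fixes a :: real
  assumes "0 < a" and "a < 1"
  shows "\<exists>E :: nat \<Rightarrow> real.
    E \<in> O[even_at_top](\<lambda>n. real n powr (- 3 / 2)) \<and>
    (\<forall>\<^sub>F n in even_at_top.
       dyck_pressure n 2 (2 * nat \<lfloor>a * real n / 2\<rfloor>) =
         ln (1 - 2 / sqrt (2 * pi * real n * a * (1 - a)) + E n))"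
proof -
  define T where "T = (\<lambda>n :: nat. 2 / sqrt (2 * pi * real n * a * (1 - a)))"
  \<comment> \<open>The witness for \<open>E\<close> is \<open>T n - R n\<close>: it turns the
    argument of \<open>ln\<close> into exactly \<open>1 - R n\<close>, so only its size remains to
    be estimated.\<close>
  define R where "R = (\<lambda>n :: nat. bridge_prob (n div 2) (nat \<lfloor>a * real n / 2\<rfloor>))"
  define C where "C = 6 * sqrt (pi * (a * (1 - a))) / (pi * (a * (1 - a)) ^ 2)"
  have large: "\<forall>\<^sub>F n in even_at_top. \<exists>m. n = 2 * m \<and> 2 \<le> a * real m"
  proof -
    \<comment> \<open>With \<open>n = 2 * m\<close> this threshold is \<open>2 \<le> a * m\<close>,
      as the error estimate requires.\<close>
    have "\<forall>\<^sub>F n in at_top. 4 / a \<le> real n"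
      using filterlim_real_sequentially by (auto simp: filterlim_at_top)
    then show ?thesis
      unfolding even_at_top_def eventually_inf_principal
    proof eventually_elim
      case (elim n)
      show ?case
      proof
        assume "n \<in> {n. even n}"
        then obtain m where "n = 2 * m" by auto
        with elim assms(1) show "\<exists>m. n = 2 * m \<and> 2 \<le> a * real m"
          by (intro exI[of _ m]) (simp add: field_simps)
      qed
    qed
  qed
  have "(\<lambda>n. T n - R n) \<in> O[even_at_top](\<lambda>n. real n powr (- 3 / 2))"
  proof (rule bigoI)
    show "\<forall>\<^sub>F n in even_at_top. norm (T n - R n) \<le>
        C * (1 / 2) powr (- 3 / 2) * norm (real n powr (- 3 / 2))"
      using large
    proof eventually_elim
      case (elim n)
      then obtain m where n: "n = 2 * m" and m: "2 \<le> a * real m" by blast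
      have "T n = 1 / sqrt (pi * (a * (1 - a) * real m))"
      proof -
        \<comment> \<open>The root of the 4 cancels the numerator 2 of \<open>T n\<close>.\<close>
        have "2 * pi * real n * a * (1 - a) = 4 * (pi * (a * (1 - a) * real m))"
          by (simp add: n)
        then show ?thesis unfolding T_def by (simp only: real_sqrt_mult) simp
      qed
      moreover have "R n = bridge_prob m (nat \<lfloor>a * real m\<rfloor>)"
        by (simp add: R_def n)
      \<comment> \<open>Passing from the half-length \<open>m\<close> to \<open>n\<close> only
        changes the constant of the error bound.\<close>
      moreover have "real m powr (- 3 / 2) = (1 / 2) powr (- 3 / 2) * real n powr (- 3 / 2)"
        by (simp add: n flip: powr_mult)
      ultimately show ?case
        using bridge_prob_error[OF assms m refl]
        by (simp add: C_def abs_minus_commute mult.assoc)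
    qed
  qed
  moreover have "\<forall>\<^sub>F n in even_at_top. dyck_pressure n 2 (2 * nat \<lfloor>a * real n / 2\<rfloor>) =
      ln (1 - T n + (T n - R n))"
    using large
  proof eventually_elim
    case (elim n)
    then obtain m where n: "n = 2 * m" and m: "2 \<le> a * real m" by blast
    define k where "k = nat \<lfloor>a * real m\<rfloor>"
    have m0: "0 < m" using m by (auto intro: gr0I)
    have "a * real m < 1 * real m"
      using assms m0 by (intro mult_strict_right_mono) auto
    then have "0 < k" "k < m"
      using m by (auto simp: k_def) linarith+
    from dyck_pressure_eq[OF this] show ?case
      by (simp add: R_def n k_def)
  qed
  ultimately show ?thesis
    unfolding T_def by blast
qed

end
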